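(* Let $G$ be a split graph with a fixed partition of $V(G)$ into a clique $C(G)$ and an independent set $I(G)$, and let $P$ be the characteristic poset of $G$. Then $\dim(P)\le 2\,\mathrm{box}(G)$.
   Context: All graphs are finite, simple and undirected; $N(u,G)$ is the neighbourhood of $u$ in $G$. A split graph is a graph whose vertex set can be partitioned into a clique and an independent set. The characteristic poset of $G$ is $P=(\{N(u,G):u\in I(G)\},\subseteq)$, the set of neighbourhoods of independent-set vertices ordered by inclusion. For a poset $P$, $\dim(P)$ is the minimum number of linear extensions of $P$ such that for every incomparable pair $x,y$ some extension has $x$ before $y$ and some has $y$ before $x$. The boxicity $\mathrm{box}(G)$ is the minimum $k$ such that $G$ is the intersection graph of $k$-dimensional axis-parallel boxes; equivalently the minimum $k$ such that $G$ is the intersection (on the common vertex set, intersecting edge sets) of $k$ interval graphs. *)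

theory Defs
  imports Complex_Main "HOL-Library.FuncSet" "HOL-Library.Ramsey"
begin

text \<open>
  A graph is given by its vertex set \<open>V\<close> and its set \<open>E\<close> of two-element edges \<open>{u, v}\<close>,
  matching \<^const>\<open>clique\<close> and \<^const>\<open>indep\<close>.
\<close>

definition simple_graph :: "'a set \<Rightarrow> 'a set set \<Rightarrow> bool" where
  "simple_graph V E \<longleftrightarrow> finite V \<and> E \<subseteq> nsets V 2"

definition neighbourhood :: "'a set \<Rightarrow> 'a set set \<Rightarrow> 'a \<Rightarrow> 'a set" where
  "neighbourhood V E u = {v \<in> V. {u, v} \<in> E}"

definition split_partition :: "'a set \<Rightarrow> 'a set set \<Rightarrow> 'a set \<Rightarrow> 'a set \<Rightarrow> bool" where
  "split_partition V E C I \<longleftrightarrow> C \<union> I = V \<and> C \<inter> I = {} \<and> clique C E \<and> indep I E"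

definition char_poset :: "'a set \<Rightarrow> 'a set set \<Rightarrow> 'a set \<Rightarrow> 'a set set" where
  "char_poset V E I = neighbourhood V E ` I"

definition inclusion_on :: "'a set set \<Rightarrow> 'a set rel" where
  "inclusion_on X = {(A, B). A \<in> X \<and> B \<in> X \<and> A \<subseteq> B}"

definition linear_extension_on :: "'b set \<Rightarrow> 'b rel \<Rightarrow> 'b rel \<Rightarrow> bool" where
  "linear_extension_on X r L \<longleftrightarrow> linear_order_on X L \<and> r \<subseteq> L"

text \<open>
  Only incomparable pairs have to be reversed, so the empty family is admissible for a chain,
  whose dimension is therefore 0.
\<close>

definition poset_dim :: "'b set \<Rightarrow> 'b rel \<Rightarrow> nat" where
  "poset_dim X r = (LEAST k. \<exists>\<L>. finite \<L> \<and> card \<L> = k \<and>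
     (\<forall>L\<in>\<L>. linear_extension_on X r L) \<and>
     (\<forall>x\<in>X. \<forall>y\<in>X. (x, y) \<notin> r \<and> (y, x) \<notin> r \<longrightarrow>
        (\<exists>L\<in>\<L>. (x, y) \<in> L) \<and> (\<exists>L\<in>\<L>. (y, x) \<in> L)))"

text \<open>
  Points of \<open>k\<close>-dimensional space are the extensional functions on \<open>{..<k}\<close>. For \<open>k = 0\<close>
  this space is a single point, so exactly the complete graphs have boxicity 0.
\<close>

definition is_box :: "nat \<Rightarrow> (nat \<Rightarrow> real) set \<Rightarrow> bool" where
  "is_box k B \<longleftrightarrow> (\<exists>l r. (\<forall>i<k. l i \<le> r i) \<and> B = (\<Pi>\<^sub>E i\<in>{..<k}. {l i..r i}))"

definition box_representation ::
  "'a set \<Rightarrow> 'a set set \<Rightarrow> nat \<Rightarrow> ('a \<Rightarrow> (nat \<Rightarrow> real) set) \<Rightarrow> bool" where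
  "box_representation V E k f \<longleftrightarrow> (\<forall>v\<in>V. is_box k (f v)) \<and>
     (\<forall>u\<in>V. \<forall>v\<in>V. u \<noteq> v \<longrightarrow> ({u, v} \<in> E \<longleftrightarrow> f u \<inter> f v \<noteq> {}))"

definition boxicity :: "'a set \<Rightarrow> 'a set set \<Rightarrow> nat" where
  "boxicity V E = (LEAST k. \<exists>f. box_representation V E k f)"

end

theory Submission
  imports Defs
begin

text \<open>
  Fix a box representation in dimension \<open>k\<close>, with \<open>v\<close> occupying \<open>[l v i, r v i]\<close> in coordinate
  \<open>i\<close>. The functions \<open>A \<mapsto> max {l c i | c \<in> A}\<close> and \<open>A \<mapsto> max {- r c i | c \<in> A}\<close> are
  monotone for inclusion, so each can be refined to a linear extension of the characteristic poset,
  which gives \<open>2k\<close> of them. If \<open>c \<in> N(u) - N(v)\<close>, some coordinate separates \<open>c\<close> from \<open>v\<close>, say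
  \<open>r v i < l c i\<close>. Every neighbour of \<open>v\<close> meets \<open>v\<close>, so the first function is at most
  \<open>r v i\<close> on \<open>N(v)\<close>, while it is at least \<open>l c i\<close> on \<open>N(u)\<close>; hence \<open>N(v)\<close> precedes \<open>N(u)\<close> in
  the corresponding extension.
\<close>

text \<open>Intersecting boxes works coordinatewise, and two nonempty intervals meet exactly when
  each starts no later than the other ends.\<close>

lemma PiE_interval_Int_nonempty_iff:
  fixes l r l' r' :: "'i \<Rightarrow> real"
  assumes "\<And>i. i \<in> J \<Longrightarrow> l i \<le> r i" "\<And>i. i \<in> J \<Longrightarrow> l' i \<le> r' i"
  shows "(\<Pi>\<^sub>E i\<in>J. {l i..r i}) \<inter> (\<Pi>\<^sub>E i\<in>J. {l' i..r' i}) \<noteq> {} \<longleftrightarrow>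
    (\<forall>i\<in>J. l i \<le> r' i \<and> l' i \<le> r i)"
  using assms by (auto simp: PiE_Int PiE_eq_empty_iff)

lemma box_representationI:
  fixes l r :: "'a \<Rightarrow> nat \<Rightarrow> real"
  assumes "\<And>v i. v \<in> V \<Longrightarrow> i < k \<Longrightarrow> l v i \<le> r v i"
    and "\<And>u v. u \<in> V \<Longrightarrow> v \<in> V \<Longrightarrow> u \<noteq> v \<Longrightarrow>
      {u, v} \<in> E \<longleftrightarrow> (\<forall>i<k. l u i \<le> r v i \<and> l v i \<le> r u i)"
  shows "box_representation V E k (\<lambda>v. \<Pi>\<^sub>E i\<in>{..<k}. {l v i..r v i})"
  unfolding box_representation_def
proof (intro conjI ballI impI)
  show "is_box k (\<Pi>\<^sub>E i\<in>{..<k}. {l v i..r v i})" if "v \<in> V" for v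
    using that assms(1) unfolding is_box_def by blast
  show "{u, v} \<in> E \<longleftrightarrow>
      (\<Pi>\<^sub>E i\<in>{..<k}. {l u i..r u i}) \<inter> (\<Pi>\<^sub>E i\<in>{..<k}. {l v i..r v i}) \<noteq> {}"
    if "u \<in> V" "v \<in> V" "u \<noteq> v" for u v
    using that assms by (subst PiE_interval_Int_nonempty_iff) auto
qed

text \<open>Replaces boxes by chosen endpoint functions, so that later arguments deal with real
  inequalities only.\<close>

lemma box_representationE:
  assumes "box_representation V E k f"
  obtains l r :: "'a \<Rightarrow> nat \<Rightarrow> real"
  where "\<And>u v. u \<in> V \<Longrightarrow> v \<in> V \<Longrightarrow> u \<noteq> v \<Longrightarrow>
    {u, v} \<in> E \<longleftrightarrow> (\<forall>i<k. l u i \<le> r v i \<and> l v i \<le> r u i)"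
proof -
  from assms have "\<forall>v\<in>V. \<exists>l r. (\<forall>i<k. l i \<le> r i) \<and> f v = (\<Pi>\<^sub>E i\<in>{..<k}. {l i..r i})"
    by (simp add: box_representation_def is_box_def)
  then obtain l r where lr: "\<And>v i. v \<in> V \<Longrightarrow> i < k \<Longrightarrow> l v i \<le> r v i"
    and f: "\<And>v. v \<in> V \<Longrightarrow> f v = (\<Pi>\<^sub>E i\<in>{..<k}. {l v i..r v i})"
    by metis
  show thesis
  proof (rule that)
    fix u v assume uv: "u \<in> V" "v \<in> V" "u \<noteq> v"
    then have "{u, v} \<in> E \<longleftrightarrow> f u \<inter> f v \<noteq> {}"
      using assms by (simp add: box_representation_def)
    also have "\<dots> \<longleftrightarrow> (\<forall>i\<in>{..<k}. l u i \<le> r v i \<and> l v i \<le> r u i)"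
      unfolding f[OF uv(1)] f[OF uv(2)] using lr uv
      by (intro PiE_interval_Int_nonempty_iff) auto
    finally show "{u, v} \<in> E \<longleftrightarrow> (\<forall>i<k. l u i \<le> r v i \<and> l v i \<le> r u i)"
      by auto
  qed
qed

text \<open>
  One coordinate per vertex \<open>w\<close>, in which \<open>w\<close> is \<open>[0,0]\<close>, its neighbours are \<open>[0,1]\<close> and all
  other vertices are \<open>[1,1]\<close>.
\<close>
lemma box_representation_exists:
  assumes "finite V"
  shows "\<exists>k f. box_representation V E k f"
proof -
  obtain w where w: "bij_betw w {..<card V} V"
    using ex_bij_betw_nat_finite[OF assms] by (auto simp: atLeast0LessThan)
  define l r :: "'a \<Rightarrow> nat \<Rightarrow> real"
    where "l v i = (if v = w i \<or> {w i, v} \<in> E then 0 else 1)"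
      and "r v i = (if v = w i then 0 else 1)" for v i
  have "box_representation V E (card V) (\<lambda>v. \<Pi>\<^sub>E i\<in>{..<card V}. {l v i..r v i})"
  proof (rule box_representationI)
    show "l v i \<le> r v i" for v i
      by (simp add: l_def r_def)
    fix u v assume uv: "u \<in> V" "v \<in> V" "u \<noteq> v"
    obtain i where i: "i < card V" "w i = u"
      using w uv(1) by (metis bij_betw_imp_surj_on imageE lessThan_iff)
    show "{u, v} \<in> E \<longleftrightarrow> (\<forall>i<card V. l u i \<le> r v i \<and> l v i \<le> r u i)"
    proof
      assume "{u, v} \<in> E"
      \<comment> \<open>An inequality could fail only as \<open>1 \<le> 0\<close>: the right end 0
        marks the vertex \<open>w i\<close>, but then the edge gives the other vertex left end
        0.\<close>
      then show "\<forall>i<card V. l u i \<le> r v i \<and> l v i \<le> r u i"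
        by (auto simp: l_def r_def insert_commute)
    next
      assume "\<forall>i<card V. l u i \<le> r v i \<and> l v i \<le> r u i"
      \<comment> \<open>In the coordinate owned by \<open>u\<close> the right end
        \<open>r u i\<close> is 0, which forces \<open>l v i = 0\<close>.\<close>
      with i have "l v i \<le> r u i" by blast
      then show "{u, v} \<in> E"
        using i uv by (auto simp: l_def r_def split: if_splits)
    qed
  qed
  then show ?thesis by blast
qed

text \<open>The \<open>LEAST\<close> in \<open>boxicity\<close> is attained because some dimension
  admits a representation.\<close>

lemma boxicity_representation:
  assumes "finite V"
  obtains f where "box_representation V E (boxicity V E) f"
  using LeastI_ex[OF box_representation_exists[OF assms]] unfolding boxicity_def by blast

text \<open>Order lexicographically by \<open>\<phi>\<close>, then by cardinality, then by an
  injective index. Proper inclusion never decreases \<open>\<phi>\<close> and strictly increases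
  cardinality, so it is respected; the index settles the remaining ties.\<close>

lemma linear_extension_refining:
  fixes \<phi> :: "'a set \<Rightarrow> real"
  assumes "finite X" "\<And>A. A \<in> X \<Longrightarrow> finite A"
    and mono: "\<And>A B. A \<in> X \<Longrightarrow> B \<in> X \<Longrightarrow> A \<subseteq> B \<Longrightarrow> \<phi> A \<le> \<phi> B"
  shows "\<exists>L. linear_extension_on X (inclusion_on X) L \<and>
    (\<forall>A\<in>X. \<forall>B\<in>X. \<phi> A < \<phi> B \<longrightarrow> (A, B) \<in> L)"
proof -
  obtain idx :: "'a set \<Rightarrow> nat" where idx: "inj_on idx X"
    using finite_imp_inj_to_nat_seg[OF assms(1)] by blast
  define L where "L = {(A, B). A \<in> X \<and> B \<in> X \<and> (\<phi> A < \<phi> B \<or> \<phi> A = \<phi> B \<and>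
    (card A < card B \<or> card A = card B \<and> idx A \<le> idx B))}"
  have "linear_order_on X L"
    unfolding linear_order_on_def partial_order_on_def preorder_on_def
  proof (intro conjI)
    show "L \<subseteq> X \<times> X" "refl_on X L"
      by (auto simp: L_def refl_on_def)
    show "trans L"
      by (auto simp: L_def trans_def)
    show "antisym L"
      using idx by (auto simp: L_def antisym_def inj_on_def)
    show "total_on X L"
      by (auto simp: L_def total_on_def)
  qed
  moreover have "inclusion_on X \<subseteq> L"
  proof clarify
    fix A B assume "(A, B) \<in> inclusion_on X"
    then have AB: "A \<in> X" "B \<in> X" "A \<subseteq> B"
      by (auto simp: inclusion_on_def)
    then have "A = B \<or> card A < card B"
      using assms(2) psubset_card_mono by blast
    with AB mono[OF AB] show "(A, B) \<in> L"
      by (auto simp: L_def)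
  qed
  ultimately show ?thesis
    unfolding linear_extension_on_def by (auto simp: L_def intro!: exI[of _ L])
qed

text \<open>An incomparable pair fails inclusion both ways, so \<open>separate\<close> applies to it
  in both orders. Different indices may yield the same extension, hence only a bound by
  \<open>card S\<close>.\<close>

lemma poset_dim_inclusion_le:
  fixes \<phi> :: "'s \<Rightarrow> 'a set \<Rightarrow> real"
  assumes "finite X" "\<And>A. A \<in> X \<Longrightarrow> finite A" "finite S"
    and mono: "\<And>s A B. s \<in> S \<Longrightarrow> A \<in> X \<Longrightarrow> B \<in> X \<Longrightarrow> A \<subseteq> B \<Longrightarrow> \<phi> s A \<le> \<phi> s B"
    and separate: "\<And>A B. A \<in> X \<Longrightarrow> B \<in> X \<Longrightarrow> \<not> A \<subseteq> B \<Longrightarrow> \<exists>s\<in>S. \<phi> s B < \<phi> s A"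
  shows "poset_dim X (inclusion_on X) \<le> card S"
proof -
  have "\<forall>s\<in>S. \<exists>L. linear_extension_on X (inclusion_on X) L \<and>
      (\<forall>A\<in>X. \<forall>B\<in>X. \<phi> s A < \<phi> s B \<longrightarrow> (A, B) \<in> L)"
    using linear_extension_refining[OF assms(1,2)] mono by blast
  then obtain L where ext: "\<And>s. s \<in> S \<Longrightarrow> linear_extension_on X (inclusion_on X) (L s)"
    and L: "\<And>s A B. s \<in> S \<Longrightarrow> A \<in> X \<Longrightarrow> B \<in> X \<Longrightarrow> \<phi> s A < \<phi> s B \<Longrightarrow> (A, B) \<in> L s"
    by metis
  have reversed: "\<exists>s\<in>S. (B, A) \<in> L s" if "A \<in> X" "B \<in> X" "(A, B) \<notin> inclusion_on X" for A B
  proof -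
    have "\<not> A \<subseteq> B" using that by (auto simp: inclusion_on_def)
    then show ?thesis using separate L that by blast
  qed
  have "poset_dim X (inclusion_on X) \<le> card (L ` S)"
    unfolding poset_dim_def
  proof (rule Least_le, intro exI[of _ "L ` S"] conjI)
    show "finite (L ` S)" using assms(3) by simp
    show "\<forall>K\<in>L ` S. linear_extension_on X (inclusion_on X) K" using ext by blast
    show "\<forall>A\<in>X. \<forall>B\<in>X. (A, B) \<notin> inclusion_on X \<and> (B, A) \<notin> inclusion_on X \<longrightarrow>
        (\<exists>K\<in>L ` S. (A, B) \<in> K) \<and> (\<exists>K\<in>L ` S. (B, A) \<in> K)"
      using reversed by blast
  qed simp
  also have "\<dots> \<le> card S" by (rule card_image_le[OF assms(3)])
  finally show ?thesis .
qed

theorem theorem3: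
  fixes V :: "'a set" and E :: "'a set set" and C I :: "'a set"
  assumes "simple_graph V E"
    and "split_partition V E C I"
  shows "poset_dim (char_poset V E I) (inclusion_on (char_poset V E I)) \<le> 2 * boxicity V E"
proof -
  let ?N = "neighbourhood V E" and ?k = "boxicity V E"
  have "finite V" and E: "E \<subseteq> nsets V 2"
    using assms(1) by (auto simp: simple_graph_def)
  have "I \<subseteq> V" and "indep I E"
    using assms(2) by (auto simp: split_partition_def)
  have "finite I" using \<open>I \<subseteq> V\<close> \<open>finite V\<close> by (rule finite_subset)
  have finN: "finite (?N v)" for v
    using \<open>finite V\<close> by (simp add: neighbourhood_def)
  have loop: "{v} \<notin> E" for v
    using E by (auto simp: nsets_def)
  obtain f where "box_representation V E ?k f"
    using boxicity_representation[OF \<open>finite V\<close>] .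
  then obtain l r :: "'a \<Rightarrow> nat \<Rightarrow> real"
    where adj: "\<And>u v. u \<in> V \<Longrightarrow> v \<in> V \<Longrightarrow> u \<noteq> v \<Longrightarrow>
      {u, v} \<in> E \<longleftrightarrow> (\<forall>i<?k. l u i \<le> r v i \<and> l v i \<le> r u i)"
    by (rule box_representationE) blast
  \<comment> \<open>The flag \<open>False\<close> reflects the axis, turning \<open>[l, r]\<close>
    into \<open>[-r, -l]\<close>. The two inequalities per coordinate thus become one condition for
    each of the \<open>2 * ?k\<close> indices.\<close>
  define lo hi :: "'a \<Rightarrow> nat \<times> bool \<Rightarrow> real"
    where "lo v s = (if snd s then l v (fst s) else - r v (fst s))"
      and "hi v s = (if snd s then r v (fst s) else - l v (fst s))" for v s
  let ?S = "{..<?k} \<times> (UNIV :: bool set)"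
  have adj': "{u, v} \<in> E \<longleftrightarrow> (\<forall>s\<in>?S. lo u s \<le> hi v s)" if "u \<in> V" "v \<in> V" "u \<noteq> v" for u v
    using adj[OF that] by (auto simp: lo_def hi_def all_bool_eq)
  \<comment> \<open>The extra element keeps the maximum meaningful for an empty neighbourhood and still lies
    below \<open>hi v s\<close> for every vertex \<open>v\<close>.\<close>
  define \<phi> where "\<phi> s A = Max (insert (Min ((\<lambda>v. hi v s) ` V)) ((\<lambda>c. lo c s) ` A))" for s A
  have "poset_dim (char_poset V E I) (inclusion_on (char_poset V E I)) \<le> card ?S"
  proof (rule poset_dim_inclusion_le)
    show "finite (char_poset V E I)" "finite ?S"
      using \<open>finite I\<close> by (simp_all add: char_poset_def)
    show fin: "finite A" if "A \<in> char_poset V E I" for A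
      using that finN by (auto simp: char_poset_def)
    show "\<phi> s A \<le> \<phi> s B" if "B \<in> char_poset V E I" "A \<subseteq> B" for s A B
      unfolding \<phi>_def using that fin by (intro Max_mono) auto
    fix A B assume "A \<in> char_poset V E I" "B \<in> char_poset V E I" "\<not> A \<subseteq> B"
    then obtain u v c where uv: "u \<in> I" "v \<in> I" "A = ?N u" "B = ?N v"
      and c: "c \<in> ?N u" "c \<notin> ?N v"
      by (auto simp: char_poset_def)
    have "c \<in> V" "{u, c} \<in> E" "{v, c} \<notin> E"
      using c by (auto simp: neighbourhood_def)
    \<comment> \<open>\<open>adj'\<close> speaks of distinct vertices only. If \<open>c = v\<close>,
      then \<open>u\<close> and \<open>v\<close> would be adjacent inside the independent
      set.\<close>
    have "c \<noteq> v"
    proof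
      assume "c = v"
      with \<open>{u, c} \<in> E\<close> loop have "u \<noteq> v" by auto
      with \<open>indep I E\<close> uv \<open>{u, c} \<in> E\<close> \<open>c = v\<close> show False
        by (auto simp: indep_def)
    qed
    have "v \<in> V" using uv \<open>I \<subseteq> V\<close> by blast
    have "{c, v} \<notin> E" using \<open>{v, c} \<notin> E\<close> by (simp add: insert_commute)
    then obtain s where s: "s \<in> ?S" "hi v s < lo c s"
      using adj'[OF \<open>c \<in> V\<close> \<open>v \<in> V\<close> \<open>c \<noteq> v\<close>] by (auto simp: not_le)
    have "lo b s \<le> hi v s" if "b \<in> ?N v" for b
    proof -
      have b: "b \<in> V" "{b, v} \<in> E"
        using that by (auto simp: neighbourhood_def insert_commute)
      moreover have "b \<noteq> v" using b loop by auto
      ultimately show ?thesis using adj'[of b v] \<open>v \<in> V\<close> s(1) by blast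
    qed
    then have "\<phi> s B \<le> hi v s"
      unfolding \<phi>_def uv(4) using finN \<open>finite V\<close> \<open>v \<in> V\<close> by (subst Max_le_iff) auto
    also have "\<dots> < lo c s" by (rule s(2))
    also have "\<dots> \<le> \<phi> s A"
      unfolding \<phi>_def uv(3) using finN c(1) by (intro Max_ge) auto
    finally show "\<exists>s\<in>?S. \<phi> s B < \<phi> s A" using s(1) by blast
  qed
  then show ?thesis by (simp add: card_cartesian_product mult.commute)
qed

end
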